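(* Let $\mathcal N$ be the real vector space of all tensors $N^{ijkl}=C^{i[jk]l}$, where $C$ ranges over all elasticity tensors in three dimensions. Then $\dim\mathcal N=6$.
   Context: Indices run over $1,2,3$. An elasticity tensor is a real fourth-rank tensor $C^{ijkl}$ on $\mathbb R^3$ with $C^{ijkl}=C^{jikl}$, $C^{ijkl}=C^{ijlk}$ (minor symmetries) and $C^{ijkl}=C^{klij}$ (major symmetry). Here $C^{i[jk]l}=\frac12(C^{ijkl}-C^{ikjl})$. *)

theory Defs
  imports "HOL-Analysis.Analysis"
begin

type_synonym tensor4 = "real^3^3^3^3"

text \<open>The component with upper indices i, j, k, l of a tensor T is \<open>T $ i $ j $ k $ l\<close>.\<close>

definition elasticity_tensor :: "tensor4 \<Rightarrow> bool" where
  "elasticity_tensor C \<longleftrightarrow>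
     (\<forall>i j k l. C $ i $ j $ k $ l = C $ j $ i $ k $ l) \<and>
     (\<forall>i j k l. C $ i $ j $ k $ l = C $ i $ j $ l $ k) \<and>
     (\<forall>i j k l. C $ i $ j $ k $ l = C $ k $ l $ i $ j)"

definition antisym_mid :: "tensor4 \<Rightarrow> tensor4" where
  "antisym_mid C = (\<chi> i j k l. (1 / 2) * (C $ i $ j $ k $ l - C $ i $ k $ j $ l))"

definition N_space :: "tensor4 set" where
  "N_space = {antisym_mid C | C. elasticity_tensor C}"

end

theory Submission
  imports Defs
begin

text \<open>
  A tensor \<open>N = C\<^bsup>i[jk]l\<^esup>\<close> is antisymmetric in \<open>(j,k)\<close> and in \<open>(i,l)\<close> and invariant under
  exchanging these two pairs, so it is a symmetric bilinear form on \<open>\<Lambda>\<^sup>2(\<real>\<^sup>3)\<close>, which the cross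
  product identifies with a symmetric bilinear form on \<open>\<real>\<^sup>3\<close>. Conversely, every such \<open>N\<close> arises from
  \<open>C\<^bsup>ijkl\<^esup> = (2/3) (N\<^bsup>ijkl\<^esup> + N\<^bsup>ijlk\<^esup>)\<close>, because the cyclic identity of Bianchi holds automatically
  in dimension three.
\<close>

unbundle cross3_syntax

text \<open>The symmetric bilinear form with diagonal \<open>fst p\<close> and off-diagonal entries \<open>snd p\<close>, where
  \<open>snd p $ m\<close> is the entry in the two positions different from \<open>m\<close>.\<close>

definition sym_form :: "(real^3) \<times> (real^3) \<Rightarrow> real^3 \<Rightarrow> real^3 \<Rightarrow> real" where
  "sym_form p v w =
     fst p $ 1 * v $ 1 * w $ 1 + fst p $ 2 * v $ 2 * w $ 2 + fst p $ 3 * v $ 3 * w $ 3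
     + snd p $ 1 * (v $ 2 * w $ 3 + v $ 3 * w $ 2)
     + snd p $ 2 * (v $ 1 * w $ 3 + v $ 3 * w $ 1)
     + snd p $ 3 * (v $ 1 * w $ 2 + v $ 2 * w $ 1)"

lemma sym_form_commute: "sym_form p v w = sym_form p w v"
  by (simp add: sym_form_def algebra_simps)

lemma sym_form_minus_left: "sym_form p (- v) w = - sym_form p v w"
  by (simp add: sym_form_def algebra_simps)

lemma sym_form_minus_right: "sym_form p v (- w) = - sym_form p v w"
  by (simp add: sym_form_def algebra_simps)

text \<open>The sum is alternating in four vectors of a three-dimensional space, hence zero.\<close>

lemma sym_form_cross3_cyclic:
  "sym_form p (x \<times> y) (z \<times> w) + sym_form p (x \<times> z) (w \<times> y) + sym_form p (x \<times> w) (y \<times> z) = 0"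
  by (simp add: sym_form_def cross3_def) algebra

definition form_tensor :: "(real^3) \<times> (real^3) \<Rightarrow> tensor4" where
  "form_tensor p =
     (\<chi> i j k l. sym_form p (axis i 1 \<times> axis l 1) (axis j 1 \<times> axis k 1))"

lemma linear_form_tensor: "linear form_tensor"
  by (rule linearI) (simp_all add: form_tensor_def sym_form_def vec_eq_iff algebra_simps)

lemma form_tensor_in_N_space: "form_tensor p \<in> N_space"
proof -
  define N where "N = form_tensor p"
  define C :: tensor4
    where "C = (\<chi> i j k l. (2 / 3) * (N $ i $ j $ k $ l + N $ i $ j $ l $ k))"
  have mid: "N $ i $ k $ j $ l = - N $ i $ j $ k $ l" for i j k l
    by (simp add: N_def form_tensor_def sym_form_minus_right
        cross_skew[of "axis k 1" "axis j 1"])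
  have outer: "N $ l $ j $ k $ i = - N $ i $ j $ k $ l" for i j k l
    by (simp add: N_def form_tensor_def sym_form_minus_left
        cross_skew[of "axis l 1" "axis i 1"])
  have pair: "N $ j $ i $ l $ k = N $ i $ j $ k $ l" for i j k l
    by (simp add: N_def form_tensor_def sym_form_commute)
  have cyclic: "N $ i $ j $ k $ l + N $ i $ k $ l $ j + N $ i $ l $ j $ k = 0" for i j k l
    using sym_form_cross3_cyclic[of p "axis i 1" "axis l 1" "axis j 1" "axis k 1"]
    by (simp add: N_def form_tensor_def)
  have "N $ k $ l $ i $ j = N $ i $ j $ k $ l" for i j k l
    using pair[of k l i j] outer[of i k j l] mid[of i j k l] by simp
  then have "elasticity_tensor C"
    by (simp add: elasticity_tensor_def C_def pair add.commute)
  moreover have "N = antisym_mid C"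
  proof -
    \<comment> \<open>By \<open>mid\<close> and \<open>cyclic\<close>, the difference without its
      factor 2/3 is \<open>3 * N $ i $ j $ k $ l\<close>; hence the 2/3 in \<open>C\<close>.\<close>
    have "(1 / 2) * (C $ i $ j $ k $ l - C $ i $ k $ j $ l) = N $ i $ j $ k $ l" for i j k l
      using mid[of i j k l] mid[of i j l k] cyclic[of i j k l]
      by (simp add: C_def field_simps)
    then show ?thesis
      by (simp add: antisym_mid_def vec_eq_iff)
  qed
  ultimately show ?thesis
    unfolding N_space_def N_def by blast
qed

text \<open>The index pairs (i,l) and (j,k) are taken in cyclic order, so their cross products are
  basis vectors with sign +1.\<close>

definition tensor_coords :: "tensor4 \<Rightarrow> (real^3) \<times> (real^3)" where
  "tensor_coords N =
     (vector [N $ 2 $ 2 $ 3 $ 3, N $ 3 $ 3 $ 1 $ 1, N $ 1 $ 1 $ 2 $ 2],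
      vector [N $ 3 $ 1 $ 2 $ 1, N $ 2 $ 1 $ 2 $ 3, N $ 2 $ 3 $ 1 $ 3])"

lemma tensor_coords_form_tensor: "tensor_coords (form_tensor p) = p"
  by (simp add: tensor_coords_def form_tensor_def sym_form_def cross3_def prod_eq_iff
      vec_eq_iff forall_3 axis_def)

lemma form_tensor_tensor_coords:
  assumes "N \<in> N_space"
  shows "form_tensor (tensor_coords N) = N"
proof -
  obtain C where C: "elasticity_tensor C" and N: "N = antisym_mid C"
    using assms by (auto simp: N_space_def)
  have left: "C $ i $ j $ k $ l = C $ j $ i $ k $ l"
    and right: "C $ i $ j $ k $ l = C $ i $ j $ l $ k"
    and major: "C $ i $ j $ k $ l = C $ k $ l $ i $ j" for i j k l
    using C by (auto simp: elasticity_tensor_def)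
  show ?thesis
    \<comment> \<open>Used as ordered rewrites, the symmetries of \<open>C\<close> settle all 81
      components.\<close>
    unfolding N
    by (simp add: tensor_coords_def form_tensor_def sym_form_def cross3_def antisym_mid_def
        vec_eq_iff forall_3 axis_def left right major)
qed

theorem proposition4:
  shows "subspace N_space \<and> dim N_space = 6"
proof -
  have N_space: "N_space = range form_tensor"
    using form_tensor_in_N_space form_tensor_tensor_coords
    by (metis image_subset_iff rangeI subsetI subset_antisym)
  have inj: "inj form_tensor"
    by (rule inj_on_inverseI[of _ tensor_coords]) (rule tensor_coords_form_tensor)
  have "dim N_space = dim (UNIV :: ((real^3) \<times> (real^3)) set)"
    unfolding N_space using linear_form_tensor inj by (intro dim_image_eq) auto
  then show ?thesis
    using linear_subspace_image[OF linear_form_tensor subspace_UNIV] by (simp add: N_space)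
qed

end
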